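(* Let $L$ be a nonsolvable Lie algebra of dimension $\le 3$ over a finite field $k$ of characteristic $p$. If $p=2$, then $L\cong W(1;\underline 2)^{(1)}$. If $p\ge 3$, then $L\cong \mathfrak{sl}(2,k)$.
   Context: Notation over a field $k$ of characteristic $p>0$: for an integer $n\ge 1$, $\mathcal O(1;\underline n)$ is the commutative associative unital $k$-algebra with basis $x^{(0)}=1,\ x=x^{(1)},\ x^{(2)},\ldots,x^{(p^n-1)}$ and product $x^{(r)}x^{(s)}=\binom{r+s}{r}x^{(r+s)}$ (read as $0$ if $r+s\ge p^n$). The derivation $\partial$ of $\mathcal O(1;\underline n)$ is given by $\partial(1)=0$, $\partial(x^{(r)})=x^{(r-1)}$ for $r\ge 1$. The Witt type Lie algebra is $W(1;\underline n)=\{f\partial\mid f\in\mathcal O(1;\underline n)\}$ with $[f\partial,g\partial]=(f\partial(g)-g\partial(f))\partial$; it has dimension $p^n$. For a Lie algebra $L$, $L^{(1)}=[L,L]$. For $p=2$, $W(1;\underline 2)^{(1)}$ is 3-dimensional with basis $\partial,\ x\partial,\ x^{(2)}\partial$. *)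

theory Defs
  imports "HOL-Analysis.Analysis" "HOL-Library.Function_Algebras"
begin

section \<open>Lie algebras\<close>

text \<open>A Lie algebra lives on a subspace \<open>L\<close> of an ambient vector space; the
  values of the bracket outside \<open>L\<close> are irrelevant.  The axiom \<open>bracket_self\<close> is the
  alternating law, which in characteristic 2 is stronger than antisymmetry.\<close>

locale lie_algebra = vector_space scl
  for scl :: "'k::field \<Rightarrow> 'a::ab_group_add \<Rightarrow> 'a" +
  fixes L :: "'a set" and bracket :: "'a \<Rightarrow> 'a \<Rightarrow> 'a"
  assumes subspace_carrier: "subspace L"
    and bracket_closed: "\<lbrakk>x \<in> L; y \<in> L\<rbrakk> \<Longrightarrow> bracket x y \<in> L"
    and bracket_add_left:
      "\<lbrakk>x \<in> L; y \<in> L; z \<in> L\<rbrakk> \<Longrightarrow> bracket (x + y) z = bracket x z + bracket y z"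
    and bracket_add_right:
      "\<lbrakk>x \<in> L; y \<in> L; z \<in> L\<rbrakk> \<Longrightarrow> bracket x (y + z) = bracket x y + bracket x z"
    and bracket_scale_left:
      "\<lbrakk>x \<in> L; y \<in> L\<rbrakk> \<Longrightarrow> bracket (scl c x) y = scl c (bracket x y)"
    and bracket_scale_right:
      "\<lbrakk>x \<in> L; y \<in> L\<rbrakk> \<Longrightarrow> bracket x (scl c y) = scl c (bracket x y)"
    and bracket_self: "x \<in> L \<Longrightarrow> bracket x x = 0"
    and jacobi: "\<lbrakk>x \<in> L; y \<in> L; z \<in> L\<rbrakk> \<Longrightarrow>
      bracket x (bracket y z) + bracket y (bracket z x) + bracket z (bracket x y) = 0"

definition derived_algebra ::
    "('k::field \<Rightarrow> 'a::ab_group_add \<Rightarrow> 'a) \<Rightarrow> ('a \<Rightarrow> 'a \<Rightarrow> 'a) \<Rightarrow> 'a set \<Rightarrow> 'a set" where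
  "derived_algebra scl bracket L = module.span scl {bracket x y |x y. x \<in> L \<and> y \<in> L}"

definition lie_solvable ::
    "('k::field \<Rightarrow> 'a::ab_group_add \<Rightarrow> 'a) \<Rightarrow> 'a set \<Rightarrow> ('a \<Rightarrow> 'a \<Rightarrow> 'a) \<Rightarrow> bool" where
  "lie_solvable scl L bracket \<longleftrightarrow>
     (\<exists>n::nat. (derived_algebra scl bracket ^^ n) L = {0})"

definition lie_isomorphic ::
    "('k::field \<Rightarrow> 'a::ab_group_add \<Rightarrow> 'a) \<Rightarrow> 'a set \<Rightarrow> ('a \<Rightarrow> 'a \<Rightarrow> 'a) \<Rightarrow>
     ('k \<Rightarrow> 'b::ab_group_add \<Rightarrow> 'b) \<Rightarrow> 'b set \<Rightarrow> ('b \<Rightarrow> 'b \<Rightarrow> 'b) \<Rightarrow> bool" where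
  "lie_isomorphic scl L bracket scl' L' bracket' \<longleftrightarrow>
     (\<exists>\<phi>. bij_betw \<phi> L L' \<and>
       (\<forall>x\<in>L. \<forall>y\<in>L. \<phi> (x + y) = \<phi> x + \<phi> y) \<and>
       (\<forall>c. \<forall>x\<in>L. \<phi> (scl c x) = scl' c (\<phi> x)) \<and>
       (\<forall>x\<in>L. \<forall>y\<in>L. \<phi> (bracket x y) = bracket' (\<phi> x) (\<phi> y)))"

section \<open>The Lie algebra sl(2,k)\<close>

definition mat_scale :: "'k::field \<Rightarrow> 'k^'n^'n \<Rightarrow> 'k^'n^'n" where
  "mat_scale c A = (\<chi> i j. c * A $ i $ j)"

definition mat_commutator :: "'k::field^'n^'n \<Rightarrow> 'k^'n^'n \<Rightarrow> 'k^'n^'n" where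
  "mat_commutator A B = A ** B - B ** A"

definition sl2 :: "('k::field^2^2) set" where
  "sl2 = {A. trace A = 0}"

section \<open>Divided power algebras and Witt type Lie algebras\<close>

text \<open>With \<open>p = CHAR('k)\<close>, an element \<open>f\<close> of O(1;n) is its coefficient sequence: \<open>f r\<close> is the
  coefficient of the basis vector \<open>x\<^sup>(\<^sup>r\<^sup>)\<close> for \<open>r < p ^ n\<close>, and \<open>f r = 0\<close> otherwise.
  Sums and differences of sequences are pointwise, but the product
  is \<open>dp_mult\<close>, never the pointwise product of functions.\<close>

definition dp_scale :: "'k::field \<Rightarrow> (nat \<Rightarrow> 'k) \<Rightarrow> (nat \<Rightarrow> 'k)" where
  "dp_scale c f = (\<lambda>r. c * f r)"

definition dp_algebra :: "nat \<Rightarrow> (nat \<Rightarrow> 'k::field) set" where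
  "dp_algebra n = {f. \<forall>r \<ge> CHAR('k) ^ n. f r = 0}"

definition dp_mult :: "nat \<Rightarrow> (nat \<Rightarrow> 'k::field) \<Rightarrow> (nat \<Rightarrow> 'k) \<Rightarrow> (nat \<Rightarrow> 'k)" where
  "dp_mult n f g = (\<lambda>t. if t < CHAR('k) ^ n
     then \<Sum>r\<le>t. of_nat (t choose r) * f r * g (t - r) else 0)"

definition dp_deriv :: "(nat \<Rightarrow> 'k::field) \<Rightarrow> (nat \<Rightarrow> 'k)" where
  "dp_deriv f = (\<lambda>r. f (Suc r))"

text \<open>W(1;n) is free of rank one over O(1;n) on the derivation \<open>\<partial>\<close>; the element \<open>f\<partial>\<close> is
  represented by its coefficient \<open>f\<close>.\<close>

definition witt_algebra :: "nat \<Rightarrow> (nat \<Rightarrow> 'k::field) set" where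
  "witt_algebra n = dp_algebra n"

definition witt_bracket :: "nat \<Rightarrow> (nat \<Rightarrow> 'k::field) \<Rightarrow> (nat \<Rightarrow> 'k) \<Rightarrow> (nat \<Rightarrow> 'k)" where
  "witt_bracket n f g = dp_mult n f (dp_deriv g) - dp_mult n g (dp_deriv f)"

definition witt_derived :: "nat \<Rightarrow> (nat \<Rightarrow> 'k::field) set" where
  "witt_derived n = derived_algebra dp_scale (witt_bracket n) (witt_algebra n)"

end

theory Submission
  imports Defs
begin

text \<open>
  The bracket of a Lie algebra spanned by at most two elements has values in a line, so such an
  algebra has trivial second derived algebra.  If \<open>L\<close> is nonsolvable of dimension at most 3,
  neither \<open>L\<close> nor its derived algebra can therefore be spanned by two elements: whenever
  \<open>a, b, c\<close> span \<open>L\<close>, both \<open>a, b, c\<close> and their three brackets are linearly independent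
  (\<open>nonsolvable_free3\<close>).  Consequently the \<open>3 \<times> 3\<close> matrix expressing
  \<open>[b,c], [c,a], [a,b]\<close> in terms of \<open>a, b, c\<close> is invertible, and the Jacobi identity says
  precisely that it is symmetric.

  The problem is thus one about a nondegenerate ternary quadratic form, namely the adjugate of this
  matrix: it vanishes at \<open>e\<close> exactly when \<open>ad e\<close> is nilpotent.  Some basis has the special shape
  \<open>a, b, c = [a,b]\<close> (\<open>generating_pair\<close>), and then the search for an isotropic vector becomes
  the equation \<open>X\<^sup>2 - d z\<^sup>2 = r\<close> with \<open>d \<noteq> 0\<close>, which is solvable over a finite field because the squares
  make up more than half of the field.  The isotropic vector \<open>e\<close> has a partner \<open>f\<close> for which
  \<open>[e,[e,f]]\<close> is a nonzero multiple of \<open>e\<close> (\<open>ad_nilpotent_element\<close>).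

  Rescaling \<open>f\<close> makes that multiple any prescribed \<open>\<mu> \<noteq> 0\<close>, and adding to \<open>f\<close> a suitable
  combination of \<open>e\<close> and \<open>h = [e,f]\<close> leads to the multiplication table
  \<open>[e,h] = \<mu> e\<close>, \<open>[e,f] = h\<close>, \<open>[h,f] = \<mu> f\<close> (\<open>standard_triple\<close>).  The last step rests on the fact that
  every scalar has the form \<open>2 s - t\<^sup>2\<close>; halving provides \<open>s\<close> in odd characteristic, and
  bijectivity of the Frobenius map provides \<open>t\<close> in characteristic 2.  Up to isomorphism
  the table leaves one algebra for each \<open>\<mu>\<close>.  For \<open>\<mu> = -2\<close> the standard matrices of
  \<open>sl(2,k)\<close> satisfy it; for \<open>\<mu> = 1\<close> in characteristic 2 it is the table of
  \<open>\<partial>, x\<partial>, x\<^sup>(\<^sup>2\<^sup>)\<partial>\<close>.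
\<close>

section \<open>Quadratic equations over finite fields\<close>

text \<open>The fibre of the squaring map over \<open>0\<close> is a point and every other fibre has at most two
  elements, so the set \<open>S\<close> of squares contains more than half of the field.  Hence \<open>S\<close> and
  \<open>c + d S\<close>, which have the same size, intersect.  The count is the same in every characteristic.\<close>

lemma finite_field_binary_form_universal:
  fixes d c :: "'k::field"
  assumes fin: "finite (UNIV :: 'k set)" and d: "d \<noteq> 0"
  shows "\<exists>y z. y\<^sup>2 - d * z\<^sup>2 = c"
proof -
  define S where "S = range (\<lambda>y::'k. y\<^sup>2)"
  define T where "T = (\<lambda>s. c + d * s) ` S"
  have finS: "finite S" unfolding S_def using fin by simp
  have cardT: "card T = card S"
    unfolding T_def by (rule card_image) (simp add: inj_on_def d)
  have S0: "0 \<in> S" unfolding S_def by (rule range_eqI[of _ _ 0]) simp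
  have fibre: "card {y::'k. y\<^sup>2 = s} \<le> 2" if "s \<in> S" for s
  proof -
    from that obtain x where "s = x\<^sup>2" unfolding S_def by auto
    then have "{y. y\<^sup>2 = s} \<subseteq> {x, - x}" by (auto simp: power2_eq_iff)
    then have "card {y. y\<^sup>2 = s} \<le> card {x, - x}" by (rule card_mono[rotated]) simp
    also have "\<dots> \<le> 2" by (simp add: card_insert_if)
    finally show ?thesis .
  qed
  have U: "(UNIV :: 'k set) = insert 0 (\<Union>s\<in>S - {0}. {y. y\<^sup>2 = s})"
    unfolding S_def by auto
  have "card (UNIV :: 'k set) \<le> Suc (card (\<Union>s\<in>S - {0}. {y::'k. y\<^sup>2 = s}))"
    by (subst U) (rule card_insert_le_m1, simp, simp)
  also have "card (\<Union>s\<in>S - {0}. {y::'k. y\<^sup>2 = s}) \<le> (\<Sum>s\<in>S - {0}. card {y::'k. y\<^sup>2 = s})"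
    using finS by (intro card_UN_le) simp
  also have "\<dots> \<le> (\<Sum>s\<in>S - {0}. 2)" using fibre by (intro sum_mono) auto
  also have "\<dots> = 2 * (card S - 1)" using finS S0 by simp
  finally have "card (UNIV :: 'k set) \<le> 2 * (card S - 1) + 1" by simp
  moreover have "card S > 0" using finS S0 by (auto simp: card_gt_0_iff)
  ultimately have less: "card (UNIV :: 'k set) < card S + card T" using cardT by simp
  have "S \<inter> T \<noteq> {}"
  proof
    assume "S \<inter> T = {}"
    then have "card S + card T = card (S \<union> T)"
      using finS unfolding T_def by (simp add: card_Un_disjoint)
    also have "\<dots> \<le> card (UNIV :: 'k set)" using fin by (intro card_mono) auto
    finally show False using less by simp
  qed
  then obtain y z where "y\<^sup>2 = c + d * z\<^sup>2" unfolding S_def T_def by auto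
  then show ?thesis by (intro exI[of _ y] exI[of _ z]) simp
qed

lemma minus_eq_self_char_2:
  fixes v :: "'k::field"
  assumes "(2::'k) = 0"
  shows "- v = v"
proof -
  have "v + v = 2 * v" by simp
  then have "v + v = 0" using assms by simp
  then show ?thesis by (rule minus_unique)
qed

lemma finite_field_two_s_minus_square:
  fixes c :: "'k::field"
  assumes fin: "finite (UNIV :: 'k set)"
  shows "\<exists>s t. 2 * s - t\<^sup>2 = c"
proof (cases "(2::'k) = 0")
  case True
  have neg: "- y = y" for y :: 'k using True by (rule minus_eq_self_char_2)
  have "inj (\<lambda>y::'k. y\<^sup>2)" by (rule injI) (auto simp: power2_eq_iff neg)
  then have "surj (\<lambda>y::'k. y\<^sup>2)" using fin by (rule finite_UNIV_inj_surj[rotated])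
  then obtain t where "c = t\<^sup>2" by (auto simp: surj_def)
  then show ?thesis by (intro exI[of _ 0] exI[of _ t]) (simp add: neg)
next
  case False
  then show ?thesis by (intro exI[of _ "c / 2"] exI[of _ 0]) simp
qed

section \<open>Linear combinations of three vectors\<close>

text \<open>Vectors are handled through their coordinates, so that identities between brackets
  turn into identities in the field.  Independence of three vectors is stated for
  triples instead of sets: it then excludes repeated entries, and coordinates can be compared.\<close>

locale triple_combinations = vector_space scale
  for scale :: "'a::field \<Rightarrow> 'b::ab_group_add \<Rightarrow> 'b"
begin

definition comb :: "'b \<Rightarrow> 'b \<Rightarrow> 'b \<Rightarrow> 'a \<Rightarrow> 'a \<Rightarrow> 'a \<Rightarrow> 'b" where
  "comb a b c x y z = scale x a + scale y b + scale z c"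

lemma span3_iff: "v \<in> span {a, b, c} \<longleftrightarrow> (\<exists>x y z. v = comb a b c x y z)"
proof -
  have "v \<in> span {a, b, c} \<longleftrightarrow> (\<exists>x y z. v - scale x a - scale y b = scale z c)"
    by (auto simp: span_breakdown_eq[of _ a] span_breakdown_eq[of _ b] span_singleton)
  also have "\<dots> \<longleftrightarrow> (\<exists>x y z. v = comb a b c x y z)"
    unfolding comb_def by (simp add: algebra_simps)
  finally show ?thesis .
qed

lemma comb_in_span: "comb a b c x y z \<in> span {a, b, c}"
  unfolding span3_iff by blast

lemma comb_add: "comb a b c x y z + comb a b c x' y' z' = comb a b c (x + x') (y + y') (z + z')"
  by (simp add: comb_def scale_left_distrib)

lemma comb_diff: "comb a b c x y z - comb a b c x' y' z' = comb a b c (x - x') (y - y') (z - z')"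
  by (simp add: comb_def scale_left_diff_distrib)

lemma comb_scale: "scale r (comb a b c x y z) = comb a b c (r * x) (r * y) (r * z)"
  by (simp add: comb_def scale_right_distrib)

lemma comb_of_combs:
  "comb (comb a b c x1 y1 z1) (comb a b c x2 y2 z2) (comb a b c x3 y3 z3) x y z =
   comb a b c (x * x1 + y * x2 + z * x3) (x * y1 + y * y2 + z * y3) (x * z1 + y * z2 + z * z3)"
  by (simp add: comb_def scale_right_distrib scale_left_distrib)

lemma comb_units: "comb a b c 1 0 0 = a" "comb a b c 0 1 0 = b" "comb a b c 0 0 1 = c" "comb a b c 0 0 0 = 0"
  by (simp_all add: comb_def)

definition free3 :: "'b \<Rightarrow> 'b \<Rightarrow> 'b \<Rightarrow> bool" where
  "free3 a b c \<longleftrightarrow> (\<forall>x y z. comb a b c x y z = 0 \<longrightarrow> x = 0 \<and> y = 0 \<and> z = 0)"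

lemma comb_eq_0_iff: "free3 a b c \<Longrightarrow> comb a b c x y z = 0 \<longleftrightarrow> x = 0 \<and> y = 0 \<and> z = 0"
  unfolding free3_def by (metis comb_units(4))

lemma free3_eq_iff:
  assumes "free3 a b c"
  shows "comb a b c x y z = comb a b c x' y' z' \<longleftrightarrow> x = x' \<and> y = y' \<and> z = z'"
proof -
  have "comb a b c x y z = comb a b c x' y' z' \<longleftrightarrow> comb a b c (x - x') (y - y') (z - z') = 0"
    by (simp flip: comb_diff)
  then show ?thesis unfolding comb_eq_0_iff[OF assms] by simp
qed

text \<open>The two vectors come from the triple itself, so they stay inside any subspace containing the
  triple.\<close>

lemma not_free3_span:
  assumes "\<not> free3 a b c"
  shows "\<exists>u\<in>{a, b, c}. \<exists>v\<in>{a, b, c}. span {a, b, c} \<subseteq> span {u, v}"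
proof -
  from assms obtain x y z where 0: "comb a b c x y z = 0" and nz: "x \<noteq> 0 \<or> y \<noteq> 0 \<or> z \<noteq> 0"
    unfolding free3_def by blast
  \<comment> \<open>A vector with a nonzero coefficient is redundant.\<close>
  have redundant: "span {u, v, w} \<subseteq> span {v, w}"
    if "comb u v w r s t = 0" "r \<noteq> 0" for u v w r s t
  proof -
    have "u = scale (- (s / r)) v + scale (- (t / r)) w"
    proof -
      have "scale r u = - (scale s v + scale t w)"
        unfolding eq_neg_iff_add_eq_0 using that(1) by (simp add: comb_def add.assoc)
      then have "scale (inverse r) (scale r u) = scale (inverse r) (- (scale s v + scale t w))"
        by simp
      then show ?thesis using that(2)
        by (simp add: scale_right_distrib scale_right_diff_distrib divide_inverse mult.commute)
    qed
    then have "u \<in> span {v, w}" by (metis insertI1 insert_commute span_add span_base span_scale)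
    then show ?thesis by (simp add: span_redundant)
  qed
  from nz show ?thesis
  proof (elim disjE)
    assume "x \<noteq> 0"
    then show ?thesis using redundant[OF 0] by blast
  next
    assume "y \<noteq> 0"
    moreover have "comb b a c y x z = 0" using 0 by (simp add: comb_def add_ac)
    ultimately have "span {b, a, c} \<subseteq> span {a, c}" using redundant by blast
    then show ?thesis by (intro bexI[of _ a] bexI[of _ c]) (auto simp: insert_commute)
  next
    assume "z \<noteq> 0"
    moreover have "comb c a b z x y = 0" using 0 by (simp add: comb_def add_ac)
    ultimately have "span {c, a, b} \<subseteq> span {a, b}" using redundant by blast
    then show ?thesis by (intro bexI[of _ a] bexI[of _ b]) (auto simp: insert_commute)
  qed
qed

text \<open>The triple extends to an independent spanning set, which has at most three elements by
  the exchange lemma; so nothing was added.\<close>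

lemma free3_spans:
  assumes "free3 u v w" and "{u, v, w} \<subseteq> span {a, b, c}"
  shows "span {u, v, w} = span {a, b, c}"
proof
  show "span {u, v, w} \<subseteq> span {a, b, c}" using assms(2) by (simp add: span_minimal)
  have distinct: "u \<noteq> v" "u \<noteq> w" "v \<noteq> w"
    using free3_eq_iff[OF assms(1), of 1 0 0 0 1 0] free3_eq_iff[OF assms(1), of 1 0 0 0 0 1]
      free3_eq_iff[OF assms(1), of 0 1 0 0 0 1] by (auto simp: comb_units)
  have "u \<notin> span {v, w}"
  proof
    assume "u \<in> span {v, w}"
    then obtain s t where "u = scale s v + scale t w"
      by (auto simp: span_breakdown_eq[of _ v] span_singleton algebra_simps)
    then have "comb u v w 1 0 0 = comb u v w 0 s t" by (simp add: comb_def)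
    then show False using free3_eq_iff[OF assms(1)] by auto
  qed
  moreover have "v \<notin> span {w}"
  proof
    assume "v \<in> span {w}"
    then obtain t where "v = scale t w" by (auto simp: span_singleton)
    then have "comb u v w 0 1 0 = comb u v w 0 0 t" by (simp add: comb_def)
    then show False using free3_eq_iff[OF assms(1)] by auto
  qed
  moreover have "w \<noteq> 0"
    using free3_eq_iff[OF assms(1), of 0 0 1 0 0 0] by (auto simp: comb_units)
  ultimately have indep: "independent {u, v, w}" by (intro independent_insertI) (auto simp: independent_empty)
  obtain t where t: "{u, v, w} \<subseteq> t" "t \<subseteq> span {a, b, c}" "independent t"
      "span {a, b, c} \<subseteq> span t"
    using maximal_independent_subset_extend[OF assms(2) indep] by metis
  have "finite t \<and> card t \<le> card {a, b, c}"
    using independent_span_bound[OF _ t(3,2)] by simp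
  moreover have "card {a, b, c} \<le> card {u, v, w}" using distinct by (simp add: card_insert_if)
  ultimately have "{u, v, w} = t" using card_seteq[OF _ t(1)] by linarith
  with t(4) show "span {a, b, c} \<subseteq> span {u, v, w}" by simp
qed

text \<open>In dimension less than 3 the triple repeats entries or is zero.\<close>

lemma small_dim_span3:
  assumes "subspace L" "finite B" "span B = L" "dim L \<le> 3"
  shows "\<exists>a b c. L = span {a, b, c}"
proof -
  obtain C where C: "C \<subseteq> L" "independent C" "L \<subseteq> span C" "card C = dim L"
    using basis_exists by blast
  have "finite C" using independent_span_bound[OF assms(2) C(2)] C(1) assms(3) by blast
  then obtain xs where xs: "set xs = C" "length xs = card C"
    using finite_distinct_list distinct_card by metis
  have L: "L = span C" using C(1,3) assms(1) by (meson span_minimal subset_antisym)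
  have "length xs \<le> 3" using xs C(4) assms(4) by simp
  then consider "xs = []" | a where "xs = [a]" | a b where "xs = [a, b]" | a b c where "xs = [a, b, c]"
    by (auto simp: numeral_3_eq_3 le_Suc_eq length_Suc_conv)
  then show ?thesis
  proof cases
    case 1
    then have "L = span {0, 0, 0}" using L xs(1)[symmetric] by simp
    then show ?thesis by blast
  next
    case (2 a)
    then have "L = span {a, a, a}" using L xs(1)[symmetric] by simp
    then show ?thesis by blast
  next
    case (3 a b)
    then have "L = span {a, b, b}" using L xs(1)[symmetric] by simp
    then show ?thesis by blast
  next
    case (4 a b c)
    then have "L = span {a, b, c}" using L xs(1)[symmetric] by simp
    then show ?thesis by blast
  qed
qed

end

section \<open>Nonsolvable Lie algebras spanned by three elements\<close>

sublocale lie_algebra \<subseteq> triple_combinations scl ..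

context lie_algebra
begin

lemma bracket_antisym:
  assumes "x \<in> L" "y \<in> L"
  shows "bracket y x = - bracket x y"
proof -
  have s: "x + y \<in> L" using assms subspace_carrier by (simp add: subspace_add)
  have "0 = bracket (x + y) (x + y)" using s by (simp add: bracket_self)
  also have "\<dots> = bracket x x + bracket x y + (bracket y x + bracket y y)"
    using assms s by (simp add: bracket_add_left bracket_add_right add_ac)
  finally show ?thesis using assms by (simp add: bracket_self eq_neg_iff_add_eq_0 add.commute)
qed

lemma comb_closed: "\<lbrakk>a \<in> L; b \<in> L; c \<in> L\<rbrakk> \<Longrightarrow> comb a b c x y z \<in> L"
  using subspace_carrier by (simp add: comb_def subspace_add subspace_scale)

text \<open>The coefficients are those of the cross product: a bracket on a three-dimensional space is a
  linear map on the exterior square, which has the cyclic basis \<open>[b,c], [c,a], [a,b]\<close>.\<close>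

lemma bracket_comb:
  assumes "a \<in> L" "b \<in> L" "c \<in> L"
  shows "bracket (comb a b c x y z) (comb a b c x' y' z') =
    comb (bracket b c) (bracket c a) (bracket a b)
      (y * z' - z * y') (z * x' - x * z') (x * y' - y * x')"
proof -
  have cl: "scl r v \<in> L" if "v \<in> L" for r v using that subspace_carrier by (simp add: subspace_scale)
  have ca: "u + v \<in> L" if "u \<in> L" "v \<in> L" for u v using that subspace_carrier by (simp add: subspace_add)
  have as: "bracket b a = - bracket a b" "bracket c b = - bracket b c" "bracket a c = - bracket c a"
    using assms by (auto intro: bracket_antisym)
  show ?thesis
    using assms unfolding comb_def
    by (simp add: cl ca bracket_add_left bracket_add_right bracket_scale_left bracket_scale_right
        bracket_self as scale_left_diff_distrib algebra_simps)
qed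

abbreviation derived :: "'a set \<Rightarrow> 'a set" where
  "derived \<equiv> derived_algebra scl bracket"

lemma derived_minimal:
  assumes "subspace M" "\<And>x y. x \<in> S \<Longrightarrow> y \<in> S \<Longrightarrow> bracket x y \<in> M"
  shows "derived S \<subseteq> M"
  unfolding derived_algebra_def by (rule span_minimal) (use assms in auto)

lemma derived_span3:
  assumes "{a, b, c} \<subseteq> L" "M \<subseteq> span {a, b, c}"
  shows "derived M \<subseteq> span {bracket b c, bracket c a, bracket a b}"
proof (rule derived_minimal)
  fix v w assume "v \<in> M" "w \<in> M"
  then obtain x y z x' y' z' where "v = comb a b c x y z" "w = comb a b c x' y' z'"
    using assms(2) span3_iff[of v a b c] span3_iff[of w a b c] by blast
  then show "bracket v w \<in> span {bracket b c, bracket c a, bracket a b}"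
    using assms(1) by (simp add: bracket_comb comb_in_span)
qed simp

lemma second_derived_span2:
  assumes "u \<in> L" "v \<in> L" "M \<subseteq> span {u, v}"
  shows "derived (derived M) = {0}"
proof -
  let ?w = "bracket u v"
  have w: "?w \<in> L" using assms bracket_closed by blast
  have "derived M \<subseteq> span {bracket v v, bracket v u, bracket u v}"
    using derived_span3[of u v v M] assms by simp
  also have "\<dots> \<subseteq> span {?w, ?w, ?w}"
    using assms bracket_antisym[of u v]
    by (intro span_minimal) (auto simp: bracket_self span_zero span_neg span_base)
  finally have "derived (derived M) \<subseteq> span {bracket ?w ?w, bracket ?w ?w, bracket ?w ?w}"
    using w by (intro derived_span3) auto
  also have "\<dots> = {0}" using w by (simp add: bracket_self)
  finally show ?thesis
    unfolding derived_algebra_def using span_zero by blast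
qed

text \<open>A dependent triple would put \<open>L\<close>, or respectively its derived algebra, inside the span of
  two elements, and two more derivation steps would reach zero.  The second conclusion expresses
  that \<open>L\<close> is perfect.\<close>

lemma nonsolvable_free3:
  assumes nonsolv: "\<not> lie_solvable scl L bracket" and L: "L = span {a, b, c}"
  shows "free3 a b c" "free3 (bracket b c) (bracket c a) (bracket a b)"
proof -
  have abc: "{a, b, c} \<subseteq> L" unfolding L by (rule span_superset)
  have not0: "(derived ^^ n) L \<noteq> {0}" for n
    using nonsolv unfolding lie_solvable_def by metis
  show "free3 a b c"
  proof (rule ccontr)
    assume "\<not> free3 a b c"
    then obtain u v where "u \<in> {a, b, c}" "v \<in> {a, b, c}" "L \<subseteq> span {u, v}"
      using not_free3_span[of a b c] unfolding L by metis
    then have "derived (derived L) = {0}"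
      using second_derived_span2[of u v L] abc by auto
    then show False using not0[of 2] by (simp add: numeral_2_eq_2)
  qed
  let ?S = "{bracket b c, bracket c a, bracket a b}"
  have S: "?S \<subseteq> L" using abc bracket_closed by blast
  show "free3 (bracket b c) (bracket c a) (bracket a b)"
  proof (rule ccontr)
    assume "\<not> free3 (bracket b c) (bracket c a) (bracket a b)"
    then obtain u v where uv: "u \<in> ?S" "v \<in> ?S" "span ?S \<subseteq> span {u, v}"
      using not_free3_span by metis
    have "derived L \<subseteq> span {u, v}" using derived_span3[OF abc, of L] L uv(3) by auto
    then have "derived (derived (derived L)) = {0}"
      using second_derived_span2[of u v "derived L"] uv(1,2) S by auto
    then show False using not0[of 3] by (simp add: numeral_3_eq_3)
  qed
qed


lemma carrier_eq_span_free3: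
  assumes "L = span {a, b, c}" "free3 u v w" "{u, v, w} \<subseteq> L"
  shows "L = span {u, v, w}"
  using free3_spans[OF assms(2)] assms(1,3) by metis

text \<open>Suppose every \<open>[u,v]\<close> lies in the plane (or line) of \<open>u\<close> and \<open>v\<close>.  On a basis this makes the
  diagonal of the structure matrix vanish, and on sums of basis vectors it makes the matrix
  skew.  But a skew matrix of size 3 is singular, contrary to the independence of the
  three brackets.\<close>

lemma generating_pair:
  assumes nonsolv: "\<not> lie_solvable scl L bracket" and L: "L = span {a, b, c}"
  shows "\<exists>u v. L = span {u, v, bracket u v}"
proof (rule ccontr)
  assume none: "\<nexists>u v. L = span {u, v, bracket u v}"
  have abc: "a \<in> L" "b \<in> L" "c \<in> L" unfolding L by (simp_all add: span_base)
  have free: "free3 a b c" and free': "free3 (bracket b c) (bracket c a) (bracket a b)"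
    using nonsolvable_free3[OF nonsolv L] by auto
  \<comment> \<open>If \<open>[u,v]\<close> had a component along \<open>w\<close>, then \<open>u, v, [u,v]\<close> would be a basis.\<close>
  have planar: "\<exists>\<alpha> \<beta>. bracket u v = comb u v w \<alpha> \<beta> 0"
    if uvw: "free3 u v w" "u \<in> L" "v \<in> L" "w \<in> L" for u v w
  proof -
    have "L = span {u, v, w}" using carrier_eq_span_free3[OF L uvw(1)] uvw by simp
    then obtain \<alpha> \<beta> \<gamma> where br: "bracket u v = comb u v w \<alpha> \<beta> \<gamma>"
      using bracket_closed[OF uvw(2,3)] span3_iff by metis
    have "\<gamma> = 0"
    proof (rule ccontr)
      assume "\<gamma> \<noteq> 0"
      have "comb u v (bracket u v) x y z = comb u v w (x + z * \<alpha>) (y + z * \<beta>) (z * \<gamma>)" for x y z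
        using comb_of_combs[of u v w 1 0 0 0 1 0 \<alpha> \<beta> \<gamma> x y z] by (simp add: comb_units br)
      then have "free3 u v (bracket u v)"
        using \<open>\<gamma> \<noteq> 0\<close> unfolding free3_def by (auto simp: comb_eq_0_iff[OF uvw(1)])
      then have "L = span {u, v, bracket u v}"
        using carrier_eq_span_free3[OF L] uvw bracket_closed by simp
      then show False using none by blast
    qed
    then show ?thesis using br by blast
  qed
  have "free3 b c a" "free3 c a b"
    using free unfolding free3_def comb_def by (metis add.assoc add.commute)+
  then obtain x2 x3 y1 y3 z1 z2 where
    "bracket b c = comb b c a y1 z1 0" "bracket c a = comb c a b z2 x2 0"
    and ab: "bracket a b = comb a b c x3 y3 0"
    using planar[of b c a] planar[of c a b] planar[of a b c] free abc by metis
  then have bc: "bracket b c = comb a b c 0 y1 z1" and ca: "bracket c a = comb a b c x2 0 z2"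
    by (simp_all add: comb_def add_ac)
  have expand: "bracket (comb a b c x y z) (comb a b c x' y' z') =
      comb (comb a b c 0 y1 z1) (comb a b c x2 0 z2) (comb a b c x3 y3 0)
        (y * z' - z * y') (z * x' - x * z') (x * y' - y * x')" for x y z x' y' z'
    using bracket_comb[OF abc] by (simp add: ab bc ca)
  \<comment> \<open>Planarity of the pair \<open>(a + b, c)\<close> and its cyclic variants makes the matrix skew.\<close>
  have 1: "y1 = - x2"
  proof -
    have "free3 (comb a b c 1 1 0) (comb a b c 0 0 1) (comb a b c 1 0 0)"
      unfolding free3_def comb_of_combs comb_eq_0_iff[OF free] by auto
    from planar[OF this] obtain \<alpha> \<beta> where
      "bracket (comb a b c 1 1 0) (comb a b c 0 0 1) =
        comb (comb a b c 1 1 0) (comb a b c 0 0 1) (comb a b c 1 0 0) \<alpha> \<beta> 0"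
      using comb_closed abc by blast
    then show ?thesis unfolding expand comb_of_combs free3_eq_iff[OF free] by simp
  qed
  have 2: "z2 = - y3"
  proof -
    have "free3 (comb a b c 0 1 1) (comb a b c 1 0 0) (comb a b c 0 1 0)"
      unfolding free3_def comb_of_combs comb_eq_0_iff[OF free] by auto
    from planar[OF this] obtain \<alpha> \<beta> where
      "bracket (comb a b c 0 1 1) (comb a b c 1 0 0) =
        comb (comb a b c 0 1 1) (comb a b c 1 0 0) (comb a b c 0 1 0) \<alpha> \<beta> 0"
      using comb_closed abc by blast
    then show ?thesis unfolding expand comb_of_combs free3_eq_iff[OF free] by simp
  qed
  have 3: "x3 = - z1"
  proof -
    have "free3 (comb a b c 1 0 1) (comb a b c 0 1 0) (comb a b c 0 0 1)"
      unfolding free3_def comb_of_combs comb_eq_0_iff[OF free] by auto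
    from planar[OF this] obtain \<alpha> \<beta> where
      "bracket (comb a b c 1 0 1) (comb a b c 0 1 0) =
        comb (comb a b c 1 0 1) (comb a b c 0 1 0) (comb a b c 0 0 1) \<alpha> \<beta> 0"
      using comb_closed abc by blast
    then show ?thesis unfolding expand comb_of_combs free3_eq_iff[OF free] by simp
  qed
  \<comment> \<open>This row vector spans the left kernel of the skew matrix.\<close>
  have "comb (bracket b c) (bracket c a) (bracket a b) z2 (- z1) y1 = comb a b c 0 0 0"
    unfolding ab bc ca comb_of_combs using 1 2 3 by (simp add: mult.commute)
  then have "z2 = 0" "z1 = 0" "y1 = 0"
    unfolding comb_units comb_eq_0_iff[OF free'] by auto
  then have "comb (bracket b c) (bracket c a) (bracket a b) 1 0 0 = 0"
    by (simp add: bc comb_units)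
  then show False unfolding comb_eq_0_iff[OF free'] by auto
qed

text \<open>With \<open>c = [a,b]\<close> the third row of the structure matrix is \<open>(0, 0, 1)\<close>.  The Jacobi sum of
  \<open>a, b, c\<close> is a combination of the three independent brackets whose coefficients are the
  differences of mirror entries, so the matrix is symmetric, and \<open>p s - q\<^sup>2\<close> is its determinant.\<close>

lemma symmetric_structure_constants:
  assumes nonsolv: "\<not> lie_solvable scl L bracket" and L: "L = span {a, b, bracket a b}"
  shows "\<exists>p q s. p * s - q\<^sup>2 \<noteq> 0 \<and>
    bracket b (bracket a b) = comb a b (bracket a b) p q 0 \<and>
    bracket (bracket a b) a = comb a b (bracket a b) q s 0"
proof -
  define c where "c = bracket a b"
  have L': "L = span {a, b, c}" using L c_def by simp
  have abc: "a \<in> L" "b \<in> L" "c \<in> L" unfolding L' by (simp_all add: span_base)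
  have free: "free3 a b c" and free': "free3 (bracket b c) (bracket c a) (bracket a b)"
    using nonsolvable_free3[OF nonsolv L'] by auto
  obtain p q r where bc: "bracket b c = comb a b c p q r"
    using bracket_closed[OF abc(2,3)] L' span3_iff by metis
  obtain q' s t where ca: "bracket c a = comb a b c q' s t"
    using bracket_closed[OF abc(3,1)] L' span3_iff by metis
  have ab: "bracket a b = comb a b c 0 0 1" by (simp add: comb_units c_def)
  have expand: "bracket (comb a b c x y z) (comb a b c x' y' z') =
      comb (bracket b c) (bracket c a) (bracket a b)
        (y * z' - z * y') (z * x' - x * z') (x * y' - y * x')" for x y z x' y' z'
    using bracket_comb[OF abc] by simp
  have "bracket a (bracket b c) = comb (bracket b c) (bracket c a) (bracket a b) 0 (- r) q"
    using expand[of 1 0 0 p q r] by (simp add: comb_units bc)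
  moreover have "bracket b (bracket c a) = comb (bracket b c) (bracket c a) (bracket a b) t 0 (- q')"
    using expand[of 0 1 0 q' s t] by (simp add: comb_units ca)
  moreover have "bracket c (bracket a b) = comb (bracket b c) (bracket c a) (bracket a b) 0 0 0"
    using expand[of 0 0 1 0 0 1] by (simp add: comb_units ab)
  ultimately have "comb (bracket b c) (bracket c a) (bracket a b) t (- r) (q - q') = 0"
    using jacobi[OF abc] by (simp add: comb_add)
  then have sym: "t = 0" "r = 0" "q' = q" unfolding comb_eq_0_iff[OF free'] by auto
  have "p * s - q\<^sup>2 \<noteq> 0"
  proof
    assume D: "p * s - q\<^sup>2 = 0"
    have "comb (bracket b c) (bracket c a) (bracket a b) s (- q) 0 = comb a b c 0 0 0"
      "comb (bracket b c) (bracket c a) (bracket a b) (- q) p 0 = comb a b c 0 0 0"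
      unfolding ab bc ca comb_of_combs using D sym by (simp_all add: power2_eq_square algebra_simps)
    then have "s = 0" "q = 0" "p = 0" unfolding comb_units comb_eq_0_iff[OF free'] by auto
    then have "comb (bracket b c) (bracket c a) (bracket a b) 1 0 0 = 0"
      by (simp add: bc sym comb_units)
    then show False unfolding comb_eq_0_iff[OF free'] by auto
  qed
  then show ?thesis using bc ca sym unfolding c_def by blast
qed

text \<open>Write \<open>D = p s - q\<^sup>2\<close>.  The adjugate of the structure matrix defines the quadratic form
  \<open>s x\<^sup>2 - 2 q x y + p y\<^sup>2 + D z\<^sup>2\<close>, the coefficient of the linear term in the characteristic polynomial
  of \<open>ad (x a + y b + z c)\<close>.  If \<open>s = 0\<close>, it vanishes at \<open>a\<close>.  Otherwise multiply it by \<open>s\<close> and put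
  \<open>y = 1\<close>, \<open>X = s x - q\<close>: the condition becomes \<open>X\<^sup>2 + D s z\<^sup>2 = - D\<close>.

  At an isotropic \<open>e\<close> the operator \<open>(ad e)\<^sup>2\<close> sends \<open>v\<close> to \<open>B(e,v) e\<close>, where \<open>B\<close> is the symmetric
  bilinear form whose matrix is the adjugate.  Since \<open>B\<close> is nondegenerate, some \<open>f\<close> has
  \<open>B(e,f) \<noteq> 0\<close>; one of \<open>a\<close> and \<open>b\<close> always serves.\<close>

lemma ad_nilpotent_element:
  assumes fin: "finite (UNIV :: 'k set)"
    and nonsolv: "\<not> lie_solvable scl L bracket" and L0: "L = span {a0, b0, c0}"
  shows "\<exists>e\<in>L. \<exists>f\<in>L. \<exists>\<kappa>. e \<noteq> 0 \<and> \<kappa> \<noteq> 0 \<and> bracket e (bracket e f) = scl \<kappa> e"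
proof -
  obtain a b where L: "L = span {a, b, bracket a b}"
    using generating_pair[OF nonsolv L0] by blast
  define c where "c = bracket a b"
  have L': "L = span {a, b, c}" using L c_def by simp
  have abc: "a \<in> L" "b \<in> L" "c \<in> L" unfolding L' by (simp_all add: span_base)
  have free: "free3 a b c" using nonsolvable_free3[OF nonsolv L'] by auto
  obtain p q s where D: "p * s - q\<^sup>2 \<noteq> 0"
    and bc: "bracket b c = comb a b c p q 0" and ca: "bracket c a = comb a b c q s 0"
    using symmetric_structure_constants[OF nonsolv L] unfolding c_def by blast
  have ab: "bracket a b = comb a b c 0 0 1" by (simp add: comb_units c_def)
  have expand: "bracket (comb a b c x y z) (comb a b c x' y' z') =
      comb a b c ((y * z' - z * y') * p + (z * x' - x * z') * q)
        ((y * z' - z * y') * q + (z * x' - x * z') * s) (x * y' - y * x')" for x y z x' y' z'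
    unfolding bracket_comb[OF abc] ab bc ca comb_of_combs by simp
  show ?thesis
  proof (cases "s = 0")
    case True
    have "bracket a (bracket a b) = scl (- q) a"
      using expand[of 1 0 0 0 1 0] expand[of 1 0 0 0 0 1] True
        comb_scale[of "- q" a b c 1 0 0] by (simp add: comb_units)
    moreover have "q \<noteq> 0" using D True by auto
    moreover have "a \<noteq> 0" using free3_eq_iff[OF free, of 1 0 0 0 0 0] by (auto simp: comb_units)
    ultimately show ?thesis using abc by (metis neg_equal_0_iff_equal)
  next
    case False
    have "- ((p * s - q\<^sup>2) * s) \<noteq> 0" using D False by simp
    then obtain X z where X: "X\<^sup>2 - (- ((p * s - q\<^sup>2) * s)) * z\<^sup>2 = - (p * s - q\<^sup>2)"
      using finite_field_binary_form_universal[OF fin] by blast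
    define x where "x = (X + q) / s"
    have sx: "X = s * x - q" unfolding x_def using False by simp
    have "s * (s * x\<^sup>2 - 2 * q * x + p + (p * s - q\<^sup>2) * z\<^sup>2) = 0"
      using X unfolding sx by (simp add: power2_eq_square algebra_simps)
    then have iso: "s * x\<^sup>2 - 2 * q * x + p + (p * s - q\<^sup>2) * z\<^sup>2 = 0" using False by simp
    define e where "e = comb a b c x 1 z"
    have e: "e \<in> L" unfolding e_def using abc by (rule comb_closed)
    have e0: "e \<noteq> 0"
      using free3_eq_iff[OF free, of x 1 z 0 0 0] by (auto simp: comb_units e_def)
    have ea: "bracket e (bracket e a) = scl (s * x - q) e"
    proof -
      have "bracket e (bracket e (comb a b c 1 0 0)) = scl (s * x - q) e"
        unfolding e_def expand comb_scale free3_eq_iff[OF free]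
        by (intro conjI) (use iso in algebra)+
      then show ?thesis by (simp add: comb_units)
    qed
    have eb: "bracket e (bracket e b) = scl (p - q * x) e"
    proof -
      have "bracket e (bracket e (comb a b c 0 1 0)) = scl (p - q * x) e"
        unfolding e_def expand comb_scale free3_eq_iff[OF free]
        by (intro conjI, algebra, use iso in algebra, algebra)
      then show ?thesis by (simp add: comb_units)
    qed
    show ?thesis
    proof (cases "s * x - q = 0")
      case True
      \<comment> \<open>\<open>B(e,a) = B(e,b) = 0\<close> would make the upper left block of the matrix singular.\<close>
      have "p - q * x \<noteq> 0"
      proof
        assume "p - q * x = 0"
        then have "p * s - q\<^sup>2 = 0" using True by algebra
        then show False using D by simp
      qed
      then show ?thesis using eb e e0 abc by blast
    next
      case False
      then show ?thesis using ea e e0 abc by blast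
    qed
  qed
qed

text \<open>On this triple \<open>ad e\<close> acts by \<open>f \<mapsto> h \<mapsto> \<mu> e \<mapsto> 0\<close>, so applying it repeatedly to a
  linear relation isolates the coefficients one after another.\<close>

lemma ad_nilpotent_free3:
  assumes "e \<in> L" "f \<in> L" "e \<noteq> 0" "\<mu> \<noteq> 0" "bracket e (bracket e f) = scl \<mu> e"
  shows "free3 e (bracket e f) f"
  unfolding free3_def
proof (intro allI impI)
  fix x y z
  let ?h = "bracket e f"
  have h: "?h \<in> L" using assms bracket_closed by blast
  assume 0: "comb e ?h f x y z = 0"
  have ad: "bracket e (comb e ?h f x y z) = comb e ?h f (y * \<mu>) z 0" for x y z
    using bracket_comb[OF assms(1) h assms(2), of 1 0 0 x y z] assms(5)
      bracket_antisym[OF assms(2,1)]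
    by (simp add: comb_units) (simp add: comb_def mult.commute)
  have zero: "bracket e 0 = 0" using ad[of 0 0 0] by (simp add: comb_units)
  have 1: "comb e ?h f (y * \<mu>) z 0 = 0" using ad[of x y z] 0 zero by simp
  have 2: "comb e ?h f (z * \<mu>) 0 0 = 0" using ad[of "y * \<mu>" z 0] 1 zero by simp
  have "z = 0" using 2 assms(3,4) by (simp add: comb_def)
  moreover from this have "y = 0" using 1 assms(3,4) by (simp add: comb_def)
  moreover from calculation have "x = 0" using 0 assms(3) by (simp add: comb_def)
  ultimately show "x = 0 \<and> y = 0 \<and> z = 0" by simp
qed

text \<open>After rescaling \<open>f\<close> so that \<open>[e,h] = \<mu> e\<close> with \<open>h = [e,f]\<close>, the Jacobi identity for \<open>e, h, f\<close>
  forces \<open>[h,f] = \<alpha> e + \<mu> f\<close>.  Replacing \<open>f\<close> by \<open>(s/\<mu>) e + (t/\<mu>) h + f\<close> changes \<open>h\<close> to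
  \<open>h + t e\<close> and subtracts \<open>2 s - t\<^sup>2\<close> from \<open>\<alpha>\<close>.\<close>

theorem standard_triple:
  assumes fin: "finite (UNIV :: 'k set)"
    and nonsolv: "\<not> lie_solvable scl L bracket" and L0: "L = span {a0, b0, c0}"
    and lam: "\<mu> \<noteq> 0"
  shows "\<exists>e h f. L = span {e, h, f} \<and> free3 e h f \<and>
    bracket e h = scl \<mu> e \<and> bracket e f = h \<and> bracket h f = scl \<mu> f"
proof -
  obtain e f0 \<kappa> where e: "e \<in> L" "e \<noteq> 0" and f0: "f0 \<in> L" and "\<kappa> \<noteq> 0"
    and ef0: "bracket e (bracket e f0) = scl \<kappa> e"
    using ad_nilpotent_element[OF fin nonsolv L0] by blast
  define f where "f = scl (\<mu> / \<kappa>) f0"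
  define h where "h = bracket e f"
  have f: "f \<in> L" unfolding f_def using f0 subspace_carrier by (simp add: subspace_scale)
  have h: "h \<in> L" unfolding h_def using e f bracket_closed by blast
  have eh: "bracket e h = scl \<mu> e"
    unfolding h_def f_def using e f0 \<open>\<kappa> \<noteq> 0\<close> ef0 bracket_closed by (simp add: bracket_scale_right)
  have free: "free3 e h f"
    using ad_nilpotent_free3[OF e(1) f e(2) lam] eh unfolding h_def by simp
  have L: "L = span {e, h, f}"
    using carrier_eq_span_free3[OF L0 free] e f h by simp
  obtain \<alpha> \<beta> \<gamma> where hf: "bracket h f = comb e h f \<alpha> \<beta> \<gamma>"
    using bracket_closed[OF h f] L span3_iff by metis
  have fe: "bracket f e = comb e h f 0 (-1) 0"
    using bracket_antisym[OF e(1) f] by (simp add: h_def comb_def)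
  have eh': "bracket e h = comb e h f \<mu> 0 0" using eh by (simp add: comb_def)
  have expand: "bracket (comb e h f x y z) (comb e h f x' y' z') =
      comb (comb e h f \<alpha> \<beta> \<gamma>) (comb e h f 0 (-1) 0) (comb e h f \<mu> 0 0)
        (y * z' - z * y') (z * x' - x * z') (x * y' - y * x')" for x y z x' y' z'
    using bracket_comb[OF e(1) h f] hf fe eh' by simp
  have "bracket e (bracket h f) = comb e h f (\<beta> * \<mu>) \<gamma> 0"
    using expand[of 1 0 0 \<alpha> \<beta> \<gamma>] unfolding comb_of_combs by (simp add: comb_units hf)
  moreover have "bracket h (bracket f e) = comb e h f 0 0 0"
    using expand[of 0 1 0 0 "-1" 0] unfolding comb_of_combs by (simp add: comb_units fe)
  moreover have "bracket f (bracket e h) = comb e h f 0 (- \<mu>) 0"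
    using expand[of 0 0 1 \<mu> 0 0] unfolding comb_of_combs by (simp add: comb_units eh')
  ultimately have "comb e h f (\<beta> * \<mu>) (\<gamma> - \<mu>) 0 = 0"
    using jacobi[OF e(1) h f] by (simp add: comb_add)
  then have \<beta>: "\<beta> = 0" and \<gamma>: "\<gamma> = \<mu>" using lam unfolding comb_eq_0_iff[OF free] by auto
  obtain s t where st: "2 * s - t\<^sup>2 = \<alpha>"
    using finite_field_two_s_minus_square[OF fin] by blast
  define f' where "f' = comb e h f (s / \<mu>) (t / \<mu>) 1"
  define h' where "h' = bracket e f'"
  have f': "f' \<in> L" unfolding f'_def using e h f by (intro comb_closed) auto
  have h': "h' \<in> L" unfolding h'_def using e f' bracket_closed by blast
  have h'_eq: "h' = comb e h f t 1 0"
    using expand[of 1 0 0 "s / \<mu>" "t / \<mu>" 1] lam unfolding comb_of_combs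
    by (simp add: comb_units h'_def f'_def)
  have eh2: "bracket e h' = scl \<mu> e"
    using expand[of 1 0 0 t 1 0] unfolding comb_of_combs
    by (simp add: comb_units h'_eq) (simp add: comb_def)
  have hf2: "bracket h' f' = scl \<mu> f'"
    unfolding h'_eq f'_def expand comb_of_combs comb_scale free3_eq_iff[OF free] \<beta> \<gamma>
    using lam st by (simp add: field_simps power2_eq_square)
  have free': "free3 e h' f'"
    using ad_nilpotent_free3[OF e(1) f' e(2) lam] eh2 unfolding h'_def by simp
  have "L = span {e, h', f'}"
    using carrier_eq_span_free3[OF L0 free'] e f' h' by simp
  then show ?thesis using free' eh2 hf2 h'_def by blast
qed


lemma bracket_standard_triple:
  assumes "L = span {e, h, f}" "bracket e h = scl \<mu> e" "bracket e f = h" "bracket h f = scl \<mu> f"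
  shows "bracket (comb e h f x y z) (comb e h f x' y' z') =
    comb e h f (\<mu> * (x * y' - y * x')) (x * z' - z * x') (\<mu> * (y * z' - z * y'))"
proof -
  have ehf: "e \<in> L" "h \<in> L" "f \<in> L" unfolding assms(1) by (simp_all add: span_base)
  have "bracket f e = - h" using bracket_antisym[OF ehf(1,3)] assms(3) by simp
  then show ?thesis
    unfolding bracket_comb[OF ehf] using assms(2-4)
    by (simp add: comb_def scale_left_diff_distrib mult.commute)
qed

text \<open>The isomorphism matches vectors with equal coordinates; it respects brackets because the
  same functions \<open>P, Q, R\<close> give the coordinates of a bracket on both sides.\<close>

lemma lie_isomorphic_by_coordinates:
  fixes T :: "'k \<Rightarrow> 'k \<Rightarrow> 'k \<Rightarrow> 'b::ab_group_add"
  assumes L: "L = span {e, h, f}" and free: "free3 e h f"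
    and br: "\<And>x y z x' y' z'. bracket (comb e h f x y z) (comb e h f x' y' z') =
      comb e h f (P x y z x' y' z') (Q x y z x' y' z') (R x y z x' y' z')"
    and T_inj: "\<And>x y z x' y' z'. T x y z = T x' y' z' \<Longrightarrow> x = x' \<and> y = y' \<and> z = z'"
    and T_range: "M = {T x y z |x y z. True}"
    and T_add: "\<And>x y z x' y' z'. T x y z + T x' y' z' = T (x + x') (y + y') (z + z')"
    and T_scale: "\<And>r x y z. scl' r (T x y z) = T (r * x) (r * y) (r * z)"
    and T_br: "\<And>x y z x' y' z'. bracket' (T x y z) (T x' y' z') =
      T (P x y z x' y' z') (Q x y z x' y' z') (R x y z x' y' z')"
  shows "lie_isomorphic scl L bracket scl' M bracket'"
proof -
  define \<phi> where "\<phi> v = (THE w. \<exists>x y z. v = comb e h f x y z \<and> w = T x y z)" for v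
  have \<phi>: "\<phi> (comb e h f x y z) = T x y z" for x y z
    unfolding \<phi>_def by (rule the_equality) (auto simp: free3_eq_iff[OF free])
  have cases: "\<exists>x y z. v = comb e h f x y z" if "v \<in> L" for v
    using that unfolding L span3_iff .
  have "inj_on \<phi> L"
  proof (rule inj_onI)
    fix v w assume "v \<in> L" "w \<in> L" "\<phi> v = \<phi> w"
    then show "v = w" using cases[of v] cases[of w] \<phi> T_inj by metis
  qed
  moreover have "\<phi> ` L = M"
  proof
    show "\<phi> ` L \<subseteq> M" unfolding T_range using cases \<phi> by fastforce
    show "M \<subseteq> \<phi> ` L"
    proof
      fix w assume "w \<in> M"
      then obtain x y z where "w = \<phi> (comb e h f x y z)" unfolding T_range using \<phi> by auto
      then show "w \<in> \<phi> ` L" using comb_in_span[of e h f x y z] L by auto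
    qed
  qed
  ultimately have "bij_betw \<phi> L M" by (simp add: bij_betw_def)
  moreover have "\<phi> (v + w) = \<phi> v + \<phi> w" if "v \<in> L" "w \<in> L" for v w
    using cases[OF that(1)] cases[OF that(2)] by (auto simp: \<phi> comb_add T_add)
  moreover have "\<phi> (scl r v) = scl' r (\<phi> v)" if "v \<in> L" for r v
    using cases[OF that] by (auto simp: \<phi> comb_scale T_scale)
  moreover have "\<phi> (bracket v w) = bracket' (\<phi> v) (\<phi> w)" if "v \<in> L" "w \<in> L" for v w
    using cases[OF that(1)] cases[OF that(2)] by (auto simp: \<phi> br T_br)
  ultimately show ?thesis unfolding lie_isomorphic_def by blast
qed

end

section \<open>The two models in coordinates\<close>

text \<open>In both models the coordinates refer to a triple \<open>e, h, f\<close> as in \<open>standard_triple\<close>.  In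
  \<open>sl(2,k)\<close> these are the upper, the diagonal and the lower standard matrix, with \<open>\<mu> = -2\<close>.\<close>

definition sl2_element :: "'k::field \<Rightarrow> 'k \<Rightarrow> 'k \<Rightarrow> 'k^2^2" where
  "sl2_element x y z =
    (\<chi> i j. if i = 1 then (if j = 1 then y else x) else (if j = 1 then z else - y))"

lemma sl2_element_inj:
  "sl2_element x y z = sl2_element x' y' z' \<Longrightarrow> x = x' \<and> y = y' \<and> z = z'"
  by (auto simp: sl2_element_def vec_eq_iff forall_2)

lemma sl2_eq: "sl2 = {sl2_element x y z |x y z. True}"
proof -
  have "A = sl2_element (A $ 1 $ 2) (A $ 1 $ 1) (A $ 2 $ 1)" if "trace A = 0" for A :: "'a^2^2"
    using that by (simp add: sl2_element_def vec_eq_iff forall_2 trace_def sum_2 eq_neg_iff_add_eq_0 add.commute)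
  moreover have "trace (sl2_element x y z) = 0" for x y z :: 'a
    by (simp add: sl2_element_def trace_def sum_2)
  ultimately show ?thesis unfolding sl2_def by blast
qed

lemma sl2_element_add:
  "sl2_element x y z + sl2_element x' y' z' = sl2_element (x + x') (y + y') (z + z')"
  by (simp add: sl2_element_def vec_eq_iff forall_2)

lemma sl2_element_scale: "mat_scale r (sl2_element x y z) = sl2_element (r * x) (r * y) (r * z)"
  by (simp add: sl2_element_def mat_scale_def vec_eq_iff forall_2)

lemma sl2_element_commutator:
  "mat_commutator (sl2_element x y z) (sl2_element x' y' z') =
    sl2_element (- 2 * (x * y' - y * x')) (x * z' - z * x') (- 2 * (y * z' - z * y'))"
  by (simp add: sl2_element_def mat_commutator_def matrix_matrix_mult_def vec_eq_iff forall_2 sum_2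
      algebra_simps)

text \<open>Here \<open>e, h, f\<close> are \<open>\<partial>, x\<partial>, x\<^sup>(\<^sup>2\<^sup>)\<partial>\<close> with \<open>\<mu> = 1\<close>.\<close>

definition witt_element :: "'k::field \<Rightarrow> 'k \<Rightarrow> 'k \<Rightarrow> nat \<Rightarrow> 'k" where
  "witt_element x y z = (\<lambda>r. if r = 0 then x else if r = 1 then y else if r = 2 then z else 0)"

lemma witt_element_inj:
  assumes "witt_element x y z = witt_element x' y' z'"
  shows "x = x' \<and> y = y' \<and> z = z'"
  using fun_cong[OF assms, of 0] fun_cong[OF assms, of 1] fun_cong[OF assms, of 2]
  by (simp add: witt_element_def)

lemma witt_element_add:
  "witt_element x y z + witt_element x' y' z' = witt_element (x + x') (y + y') (z + z')"
  by (auto simp: witt_element_def)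

lemma witt_element_scale: "dp_scale r (witt_element x y z) = witt_element (r * x) (r * y) (r * z)"
  by (auto simp: witt_element_def dp_scale_def)

text \<open>The coefficient of \<open>x\<^sup>(\<^sup>3\<^sup>)\<partial>\<close> in a bracket vanishes because the only bracket of basis
  elements that involves it is \<open>[x\<partial>, x\<^sup>(\<^sup>3\<^sup>)\<partial>] = 2 x\<^sup>(\<^sup>3\<^sup>)\<partial>\<close>; hence \<open>W(1;2)\<close> is not perfect in characteristic 2.\<close>

lemma witt_bracket_char_2:
  fixes f g :: "nat \<Rightarrow> 'k::field"
  assumes char: "CHAR('k) = 2" and f: "f \<in> dp_algebra 2" and g: "g \<in> dp_algebra 2"
  shows "witt_bracket 2 f g =
    witt_element (f 0 * g 1 - f 1 * g 0) (f 0 * g 2 - f 2 * g 0)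
      (f 0 * g 3 - f 3 * g 0 + (f 1 * g 2 - f 2 * g 1))"
proof
  fix t :: nat
  have two: "(2::'k) = 0" using of_nat_CHAR[where 'a = 'k] char by simp
  have f4: "f 4 = 0" and g4: "g 4 = 0" using f g char by (auto simp: dp_algebra_def)
  have three: "(3::'k) = 1" using two by (metis add_0 numeral_Bit1 numeral_One one_add_one)
  have neg: "- v = v" for v :: 'k using two by (rule minus_eq_self_char_2)
  have minus: "u - v = u + v" for u v :: 'k by (metis diff_conv_add_uminus neg)
  consider "t = 0" | "t = 1" | "t = 2" | "t = 3" | "t \<ge> 4" by linarith
  then show "witt_bracket 2 f g t =
    witt_element (f 0 * g 1 - f 1 * g 0) (f 0 * g 2 - f 2 * g 0)
      (f 0 * g 3 - f 3 * g 0 + (f 1 * g 2 - f 2 * g 1)) t"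
  proof cases
    case 1
    then show ?thesis
      by (simp add: witt_bracket_def dp_mult_def dp_deriv_def char witt_element_def)
  next
    case 2
    then show ?thesis
      by (simp add: witt_bracket_def dp_mult_def dp_deriv_def char witt_element_def
          eval_nat_numeral mult.commute)
  next
    case 3
    have "{..2::nat} = {0, 1, 2}" by auto
    with 3 show ?thesis
      by (simp add: witt_bracket_def dp_mult_def dp_deriv_def char witt_element_def two minus
         eval_nat_numeral algebra_simps)
  next
    case 4
    have "{..3::nat} = {0, 1, 2, 3}" by auto
    moreover have "3 choose 2 = (3::nat)" by (simp add: eval_nat_numeral)
    ultimately show ?thesis using 4 f4 g4
      by (simp add: witt_bracket_def dp_mult_def dp_deriv_def char witt_element_def three
          mult.commute flip: numeral_2_eq_2)
  next
    case 5
    then show ?thesis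
      by (simp add: witt_bracket_def dp_mult_def char witt_element_def)
  qed
qed

lemma vector_space_dp_scale: "vector_space (dp_scale :: 'k::field \<Rightarrow> (nat \<Rightarrow> 'k) \<Rightarrow> (nat \<Rightarrow> 'k))"
  by unfold_locales (auto simp: dp_scale_def fun_eq_iff algebra_simps)

lemma witt_element_bracket:
  fixes x y z x' y' z' :: "'k::field"
  assumes "CHAR('k) = 2"
  shows "witt_bracket 2 (witt_element x y z) (witt_element x' y' z') =
    witt_element (x * y' - y * x') (x * z' - z * x') (y * z' - z * y')"
proof -
  have "witt_element x y z \<in> dp_algebra 2" for x y z :: 'k
    unfolding dp_algebra_def using assms by (simp add: witt_element_def)
  from witt_bracket_char_2[OF assms this this] show ?thesis
    by (simp add: witt_element_def)
qed

lemma witt_derived_char_2: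
  assumes char: "CHAR('k::field) = 2"
  shows "(witt_derived 2 :: (nat \<Rightarrow> 'k) set) = {witt_element x y z |x y z. True}" (is "_ = ?M")
proof
  interpret vector_space "dp_scale :: 'k \<Rightarrow> (nat \<Rightarrow> 'k) \<Rightarrow> (nat \<Rightarrow> 'k)"
    by (rule vector_space_dp_scale)
  let ?B = "{witt_bracket 2 f g |f g. f \<in> witt_algebra 2 \<and> g \<in> witt_algebra 2} :: (nat \<Rightarrow> 'k) set"
  have D: "witt_derived 2 = span ?B"
    by (simp add: witt_derived_def derived_algebra_def)
  have "0 = witt_element 0 0 (0::'k)" by (auto simp: witt_element_def)
  then have sub: "subspace ?M"
    by (intro subspaceI) (blast | (auto simp: witt_element_add witt_element_scale; blast))+
  have "?B \<subseteq> ?M"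
    unfolding witt_algebra_def using witt_bracket_char_2[OF char] by blast
  then show "witt_derived 2 \<subseteq> ?M" unfolding D using sub by (rule span_minimal)
  have mem: "witt_element x y z \<in> witt_algebra 2" for x y z :: 'k
    unfolding witt_algebra_def dp_algebra_def using char by (simp add: witt_element_def)
  have B: "witt_element (x * y' - y * x') (x * z' - z * x') (y * z' - z * y') \<in> ?B"
    for x y z x' y' z' :: 'k
    using mem witt_element_bracket[OF char] by (metis (mono_tags, lifting) mem_Collect_eq)
  have units: "witt_element 1 0 0 \<in> ?B" "witt_element 0 1 0 \<in> ?B" "witt_element 0 0 1 \<in> ?B"
    using B[of 1 1 0 0 0 0] B[of 1 0 0 0 1 0] B[of 0 0 1 0 1 0] by simp_all
  show "?M \<subseteq> witt_derived 2"
  proof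
    fix g assume "g \<in> ?M"
    then obtain x y z where "g = dp_scale x (witt_element 1 0 0) + dp_scale y (witt_element 0 1 0)
        + dp_scale z (witt_element 0 0 1)"
      by (auto simp: witt_element_add witt_element_scale)
    then show "g \<in> witt_derived 2"
      unfolding D using units by (simp add: span_add span_scale span_base)
  qed
qed

section \<open>Classification\<close>

theorem theorem3p2:
  fixes scl :: "'k::{field,finite} \<Rightarrow> 'a::ab_group_add \<Rightarrow> 'a"
    and L :: "'a set"
    and bracket :: "'a \<Rightarrow> 'a \<Rightarrow> 'a"
    and p :: nat
  assumes "CHAR('k) = p"
    and "lie_algebra scl L bracket"
    and "\<exists>B. finite B \<and> module.span scl B = L"
    and "vector_space.dim scl L \<le> 3"
    and "\<not> lie_solvable scl L bracket"
  shows "(p = 2 \<longrightarrow>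
            lie_isomorphic scl L bracket dp_scale (witt_derived 2) (witt_bracket 2)) \<and>
         (p \<ge> 3 \<longrightarrow>
            lie_isomorphic scl L bracket mat_scale sl2 mat_commutator)"
proof -
  interpret lie_algebra scl L bracket by fact
  obtain a b c where abc: "L = span {a, b, c}"
    using small_dim_span3[OF subspace_carrier] assms(3,4) by blast
  have triple: "\<exists>e h f. L = span {e, h, f} \<and> free3 e h f \<and>
      bracket e h = scl \<mu> e \<and> bracket e f = h \<and> bracket h f = scl \<mu> f" if "\<mu> \<noteq> 0" for \<mu>
    using standard_triple[OF _ assms(5) abc that] by simp
  show ?thesis
  proof (intro conjI impI)
    assume "p = 2"
    then have char: "CHAR('k) = 2" using assms(1) by simp
    obtain e h f where t: "L = span {e, h, f}" "free3 e h f"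
      "bracket e h = scl 1 e" "bracket e f = h" "bracket h f = scl 1 f"
      using triple[of 1] by auto
    have wb: "witt_bracket 2 (witt_element x y z) (witt_element x' y' z') =
        witt_element (1 * (x * y' - y * x')) (x * z' - z * x') (1 * (y * z' - z * y'))"
      for x y z x' y' z' :: 'k
      using witt_element_bracket[OF char, of x y z x' y' z'] by simp
    show "lie_isomorphic scl L bracket dp_scale (witt_derived 2) (witt_bracket 2)"
      using t(1,2) bracket_standard_triple[OF t(1,3-5)] witt_element_inj witt_derived_char_2[OF char]
        witt_element_add witt_element_scale wb
      by (rule lie_isomorphic_by_coordinates)
  next
    assume "p \<ge> 3"
    then have "\<not> CHAR('k) dvd 2" using assms(1) by (auto dest: dvd_imp_le)
    then have "of_nat 2 \<noteq> (0::'k)"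
      using of_nat_eq_0_iff_char_dvd[of 2, where 'a = 'k] by blast
    then have "- 2 \<noteq> (0::'k)" by simp
    from triple[OF this] obtain e h f where t: "L = span {e, h, f}" "free3 e h f"
      "bracket e h = scl (- 2) e" "bracket e f = h" "bracket h f = scl (- 2) f"
      by blast
    show "lie_isomorphic scl L bracket mat_scale sl2 mat_commutator"
      using t(1,2) bracket_standard_triple[OF t(1,3-5)] sl2_element_inj sl2_eq
        sl2_element_add sl2_element_scale sl2_element_commutator
      by (rule lie_isomorphic_by_coordinates)
  qed
qed

end
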